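(* Any cell probe data structure with cell size $w$ bits that uses a non-adaptive query algorithm to solve (i) reachability in directed graphs on $n$ nodes, or (ii) subgraph connectivity in graphs on $n$ nodes, must either have query time $t_q=\Omega(n/w)$ or update time $t_u=\Omega(n/w)$. Any cell probe data structure with cell size $w$ bits that solves range mode on arrays of length $n$ with a non-adaptive query algorithm must have $t_q t_u=\Omega(n/w^2)$.
   Context: **Cell probe model.** A data structure consists of a collection of memory cells, each storing $w$ bits and each having an integer address in $[2^w]=\{1,\dots,2^w\}$. In a preprocessing phase the data structure receives an input and initializes its cells (with unrestricted computation). A query algorithm, given a query, probes (reads) cells one at a time; the cell probed at each step may in general depend arbitrarily on the query and the contents of all cells probed so far; after probing some cells it terminates with the answer. An update algorithm, given an update, reads and/or writes cells (both are called probing); the cell probed and the contents written at each step may in general depend arbitrarily on the update and the contents of the cells probed so far. Only probes are charged: the query time $t_q$ and update time $t_u$ are the (worst-case) numbers of cells probed when answering a query, respectively processing an update. Data structures are deterministic and always correct. **Non-adaptive query algorithm.** The cells probed when answering a query depend only on the query, and not on the contents of previously probed cells. The update algorithm is unrestricted (it may be adaptive). **Reachability in directed graphs.** In a preprocessing phase we are given a directed graph with $n$ nodes and $m$ edges. Updates insert directed edges into the graph. A query is specified by two nodes $u,v$, and asks whether there is a directed path from $u$ to $v$. **Subgraph connectivity.** In a preprocessing phase we are given an undirected graph with $n$ nodes and $m$ edges. Updates turn nodes on and off. A query is specified by two nodes $u,v$, and asks whether there is a path from $u$ to $v$ using only on nodes. **Range mode.** In a preprocessing phase we are given an array $A[1:n]$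 of integers. Updates are value updates $A[i]\leftarrow A[i]+x$. A query is specified by two indices $i$ and $j$, and asks for the most frequently occurring integer in the subarray $A[i:j]$. **Asymptotics.** The data structures must work for all inputs of the respective problem with parameter $n$ (for the graph problems, with any number $m$ of edges). The $\Omega(\cdot)$'s hide absolute positive constants, independent of $n$, $w$ and the data structure. *)

theory Defs
  imports Complex_Main "HOL-Library.FuncSet"
begin

text \<open>
  A cell holds a \<open>w\<close>-bit word, represented by a number below \<open>2 ^ w\<close>.
\<close>

type_synonym memory = "nat \<Rightarrow> nat"

definition memories :: "nat \<Rightarrow> memory set" where
  "memories w = {1..2 ^ w} \<rightarrow>\<^sub>E {..<2 ^ w}"

text \<open>
  Algorithms are decision trees: the continuation of a read receives the contents of the cell,
  so everything that happens later may depend on all the contents read so far.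
\<close>

datatype 'a query_alg =
  Answer 'a
| Probe nat "nat \<Rightarrow> 'a query_alg"

datatype update_alg =
  Done
| Read nat "nat \<Rightarrow> update_alg"
| Write nat nat update_alg

primrec query_ok :: "nat \<Rightarrow> 'a query_alg \<Rightarrow> bool" where
  "query_ok w (Answer x) \<longleftrightarrow> True"
| "query_ok w (Probe a k) \<longleftrightarrow> a \<in> {1..2 ^ w} \<and> (\<forall>c. c < 2 ^ w \<longrightarrow> query_ok w (k c))"

primrec answer :: "'a query_alg \<Rightarrow> memory \<Rightarrow> 'a" where
  "answer (Answer x) M = x"
| "answer (Probe a k) M = answer (k (M a)) M"

primrec query_cells :: "'a query_alg \<Rightarrow> memory \<Rightarrow> nat set" where
  "query_cells (Answer x) M = {}"
| "query_cells (Probe a k) M = insert a (query_cells (k (M a)) M)"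

primrec update_ok :: "nat \<Rightarrow> update_alg \<Rightarrow> bool" where
  "update_ok w Done \<longleftrightarrow> True"
| "update_ok w (Read a k) \<longleftrightarrow> a \<in> {1..2 ^ w} \<and> (\<forall>c. c < 2 ^ w \<longrightarrow> update_ok w (k c))"
| "update_ok w (Write a c p) \<longleftrightarrow> a \<in> {1..2 ^ w} \<and> c < 2 ^ w \<and> update_ok w p"

primrec exec :: "update_alg \<Rightarrow> memory \<Rightarrow> memory" where
  "exec Done M = M"
| "exec (Read a k) M = exec (k (M a)) M"
| "exec (Write a c p) M = exec p (M(a := c))"

primrec update_cells :: "update_alg \<Rightarrow> memory \<Rightarrow> nat set" where
  "update_cells Done M = {}"
| "update_cells (Read a k) M = insert a (update_cells (k (M a)) M)"
| "update_cells (Write a c p) M = insert a (update_cells p (M(a := c)))"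

text \<open>
  A dynamic problem is given by the states in which it may start (the inputs of the
  preprocessing phase), the updates permitted in each state and their effect, the queries,
  and the set of acceptable answers to a query in a given state.
\<close>

record ('s, 'u, 'q, 'a) problem =
  inputs :: "'s set"
  updates :: "'s \<Rightarrow> 'u set"
  effect :: "'s \<Rightarrow> 'u \<Rightarrow> 's"
  queries :: "'q set"
  answers :: "'s \<Rightarrow> 'q \<Rightarrow> 'a set"

record ('s, 'u, 'q, 'a) data_structure =
  preprocess :: "'s \<Rightarrow> memory"
  update_of :: "'u \<Rightarrow> update_alg"
  query_of :: "'q \<Rightarrow> 'a query_alg"

text \<open>
  The pairs of a problem state and the memory representing it that arise from preprocessing
  some input and then processing a finite sequence of updates.
\<close>

inductive reached ::
  "('s, 'u, 'q, 'a) problem \<Rightarrow> ('s, 'u, 'q, 'a) data_structure \<Rightarrow> 's \<Rightarrow> memory \<Rightarrow> bool"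
  for P D where
  start: "s \<in> inputs P \<Longrightarrow> reached P D s (preprocess D s)"
| step: "reached P D s M \<Longrightarrow> u \<in> updates P s \<Longrightarrow>
    reached P D (effect P s u) (exec (update_of D u) M)"

definition solves ::
  "nat \<Rightarrow> ('s, 'u, 'q, 'a) problem \<Rightarrow> ('s, 'u, 'q, 'a) data_structure \<Rightarrow> bool" where
  "solves w P D \<longleftrightarrow>
    (\<forall>s\<in>inputs P. preprocess D s \<in> memories w) \<and>
    (\<forall>s M. reached P D s M \<longrightarrow> (\<forall>u\<in>updates P s. update_ok w (update_of D u))) \<and>
    (\<forall>q\<in>queries P. query_ok w (query_of D q)) \<and>
    (\<forall>s M. reached P D s M \<longrightarrow> (\<forall>q\<in>queries P. answer (query_of D q) M \<in> answers P s q))"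

definition nonadaptive_queries ::
  "nat \<Rightarrow> ('s, 'u, 'q, 'a) problem \<Rightarrow> ('s, 'u, 'q, 'a) data_structure \<Rightarrow> bool" where
  "nonadaptive_queries w P D \<longleftrightarrow>
    (\<forall>q\<in>queries P. \<forall>M\<in>memories w. \<forall>M'\<in>memories w.
      query_cells (query_of D q) M = query_cells (query_of D q) M')"

text \<open>
  Worst-case numbers of cells probed. Probing a cell again is not charged again, so these
  are at most the numbers of probing steps. For a data structure with cell size \<open>w\<close>
  the suprema are over sets of numbers bounded by \<open>2 ^ w\<close>, hence they are maxima.
\<close>

definition query_time ::
  "('s, 'u, 'q, 'a) problem \<Rightarrow> ('s, 'u, 'q, 'a) data_structure \<Rightarrow> nat" where
  "query_time P D =
    Sup {card (query_cells (query_of D q) M) | s M q. reached P D s M \<and> q \<in> queries P}"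

definition update_time ::
  "('s, 'u, 'q, 'a) problem \<Rightarrow> ('s, 'u, 'q, 'a) data_structure \<Rightarrow> nat" where
  "update_time P D =
    Sup {card (update_cells (update_of D u) M) | s M u. reached P D s M \<and> u \<in> updates P s}"

text \<open>
  Graphs are simple, with node set \<open>{1..n}\<close>; only edges not yet present are inserted, and only
  nodes that are off (on) are turned on (off). Every data structure that also copes with
  loops or with redundant updates solves these problems in particular.
\<close>

definition reachability ::
  "nat \<Rightarrow> ((nat \<times> nat) set, nat \<times> nat, nat \<times> nat, bool) problem" where
  "reachability n = \<lparr>
    inputs = {E. E \<subseteq> {1..n} \<times> {1..n} \<and> irrefl E},
    updates = (\<lambda>E. {(u, v). u \<in> {1..n} \<and> v \<in> {1..n} \<and> u \<noteq> v \<and> (u, v) \<notin> E}),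
    effect = (\<lambda>E e. insert e E),
    queries = {1..n} \<times> {1..n},
    answers = (\<lambda>E (u, v). {(u, v) \<in> E\<^sup>*})\<rparr>"

text \<open>
  Undirected graphs are symmetric edge relations. A state consists of the edges and the set of
  nodes that are on, \<open>S\<^sub>0\<close> being the latter right after preprocessing. The update
  \<open>(v, b)\<close> turns \<open>v\<close> on if \<open>b\<close> holds and off otherwise. The endpoints of a path belong to
  the path, so they have to be on as well.
\<close>

definition subgraph_connectivity ::
  "nat \<Rightarrow> nat set \<Rightarrow> ((nat \<times> nat) set \<times> nat set, nat \<times> bool, nat \<times> nat, bool) problem" where
  "subgraph_connectivity n S\<^sub>0 = \<lparr>
    inputs = {E. E \<subseteq> {1..n} \<times> {1..n} \<and> irrefl E \<and> sym E} \<times> {S\<^sub>0},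
    updates = (\<lambda>(E, S). {(v, b). v \<in> {1..n} \<and> (b \<longleftrightarrow> v \<notin> S)}),
    effect = (\<lambda>(E, S) (v, b). (E, if b then insert v S else S - {v})),
    queries = {1..n} \<times> {1..n},
    answers = (\<lambda>(E, S) (u, v). {u \<in> S \<and> v \<in> S \<and> (u, v) \<in> (Restr E S)\<^sup>*})\<rparr>"

text \<open>
  The array entries range over a set \<open>Z\<close> of integers. A memory of finitely many \<open>w\<close>-bit cells
  cannot represent unbounded integers, so for \<open>Z = UNIV\<close> and \<open>n > 0\<close> the problem has no
  solution at all; bounded universes are the case of interest. If several integers are most
  frequent, each of them is an acceptable answer.
\<close>

definition range_mode ::
  "nat \<Rightarrow> int set \<Rightarrow> (nat \<Rightarrow> int, nat \<times> int, nat \<times> nat, int) problem" where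
  "range_mode n Z = \<lparr>
    inputs = {1..n} \<rightarrow>\<^sub>E Z,
    updates = (\<lambda>A. {(i, x). i \<in> {1..n} \<and> A i + x \<in> Z}),
    effect = (\<lambda>A (i, x). A(i := A i + x)),
    queries = {(i, j). 1 \<le> i \<and> i \<le> j \<and> j \<le> n},
    answers = (\<lambda>A (i, j).
      {a. is_arg_max (\<lambda>b. card {l \<in> {i..j}. A l = b}) (\<lambda>b. b \<in> A ` {i..j}) a})\<rparr>"

end

theory Submission
  imports Defs
begin

text \<open>
  Consider \<open>k\<close> sets \<open>X\<^sub>i \<subseteq> {0..<m}\<close> such that, whatever the sets are, a state can be reached in
  which the update \<open>j\<close> followed by the query \<open>i\<close> reveals whether \<open>j \<in> X\<^sub>i\<close>. Since the queries
  are non-adaptive, the \<open>k\<close> queries read a fixed set \<open>R\<close> of at most \<open>k t\<^sub>q\<close> cells. The contents of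
  \<open>R\<close> before the update, together with the at most \<open>t\<^sub>u\<close> cells (addresses and new contents)
  probed by each of the \<open>m\<close> updates, performed separately from that state, determine all answers
  and hence all \<open>k m\<close> bits of the sets. So \<open>k m \<le> k t\<^sub>q w + 2 m t\<^sub>u w\<close>. For the graph problems
  take \<open>k = m = \<Theta>(n)\<close>; for range mode \<open>k m = \<Theta>(n)\<close> with \<open>m = 2 t\<^sub>q w\<close>.
\<close>

section \<open>The cell probe model\<close>

lemma query_cells_subset:
  "query_ok w q \<Longrightarrow> M \<in> memories w \<Longrightarrow> query_cells q M \<subseteq> {1..2 ^ w}"
proof (induction q)
  case (Probe a k)
  then have "M a < 2 ^ w" by (auto simp: memories_def)
  with Probe show ?case by auto
qed simp

lemma exec_memories_update_cells_subset:
  "update_ok w p \<Longrightarrow> M \<in> memories w \<Longrightarrow>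
    exec p M \<in> memories w \<and> update_cells p M \<subseteq> {1..2 ^ w}"
proof (induction p arbitrary: M)
  case (Read a k)
  then have "M a < 2 ^ w" by (auto simp: memories_def)
  with Read show ?case by auto
next
  case (Write a c p)
  then have "M(a := c) \<in> memories w"
    by (auto simp: memories_def PiE_def extensional_def)
  with Write show ?case by auto
qed simp

lemma answer_cong:
  "(\<And>a. a \<in> query_cells q M \<Longrightarrow> M a = M' a) \<Longrightarrow> answer q M = answer q M'"
proof (induction q)
  case (Probe a k)
  have "answer (k (M a)) M = answer (k (M a)) M'" 
    by (rule Probe.IH) (simp, rule Probe.prems, simp)
  moreover have "M a = M' a" by (rule Probe.prems) simp
  ultimately show ?case by simp
qed simp

lemma exec_outside_update_cells: "a \<notin> update_cells p M \<Longrightarrow> exec p M a = M a"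
  by (induction p arbitrary: M) auto

section \<open>Worst-case probe counts in reached states\<close>

lemma reached_memories:
  assumes "solves w P D" "reached P D s M"
  shows "M \<in> memories w"
  using assms(2)
proof induction
  case (start s)
  then show ?case using assms(1) by (simp add: solves_def)
next
  case (step s M u)
  then have "update_ok w (update_of D u)" using assms(1) unfolding solves_def by blast
  then show ?case using exec_memories_update_cells_subset step.IH by blast
qed

text \<open>\<open>Sup\<close> on \<open>nat\<close> is an upper bound only for sets that are
  bounded above; here the \<open>2 ^ w\<close> addresses provide the bound.\<close>

lemma card_query_cells_le:
  assumes "solves w P D" "reached P D s M" "q \<in> queries P"
  shows "card (query_cells (query_of D q) M) \<le> query_time P D"
proof -
  let ?T = "{card (query_cells (query_of D q) M) | s M q. reached P D s M \<and> q \<in> queries P}"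
  have "t \<le> 2 ^ w" if "t \<in> ?T" for t
  proof -
    from that obtain s M q where
      t: "t = card (query_cells (query_of D q) M)" "reached P D s M" "q \<in> queries P"
      by blast
    then have "query_cells (query_of D q) M \<subseteq> {1..2 ^ w}"
      using assms(1) reached_memories query_cells_subset by (metis solves_def)
    from card_mono[OF finite_atLeastAtMost this] show ?thesis using t(1) by simp
  qed
  then have "bdd_above ?T" by (meson bdd_aboveI)
  moreover have "card (query_cells (query_of D q) M) \<in> ?T" using assms by blast
  ultimately show ?thesis unfolding query_time_def by (rule cSup_upper[rotated])
qed

lemma reached_update_cells_subset:
  assumes "solves w P D" "reached P D s M" "u \<in> updates P s"
  shows "update_cells (update_of D u) M \<subseteq> {1..2 ^ w}"
  using assms reached_memories exec_memories_update_cells_subset by (metis solves_def)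

lemma card_update_cells_le:
  assumes "solves w P D" "reached P D s M" "u \<in> updates P s"
  shows "card (update_cells (update_of D u) M) \<le> update_time P D"
proof -
  let ?T = "{card (update_cells (update_of D u) M) | s M u. reached P D s M \<and> u \<in> updates P s}"
  have "t \<le> 2 ^ w" if "t \<in> ?T" for t
  proof -
    from that obtain s M u where
      t: "t = card (update_cells (update_of D u) M)" "reached P D s M" "u \<in> updates P s"
      by blast
    then have "update_cells (update_of D u) M \<subseteq> {1..2 ^ w}"
      using assms(1) reached_update_cells_subset by metis
    from card_mono[OF finite_atLeastAtMost this] show ?thesis using t(1) by simp
  qed
  then have "bdd_above ?T" by (meson bdd_aboveI)
  moreover have "card (update_cells (update_of D u) M) \<in> ?T" using assms by blast
  ultimately show ?thesis unfolding update_time_def by (rule cSup_upper[rotated])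
qed

lemma reached_answer:
  assumes "solves w P D" "reached P D s M" "q \<in> queries P"
  shows "answer (query_of D q) M \<in> answers P s q"
  using assms by (auto simp: solves_def)

text \<open>Without probes the answer would be the same in both memories. This serves the small
  \<open>n\<close> about which the encoding says nothing, and the positivity of \<open>m\<close> in
  the range mode bound.\<close>

lemma query_time_pos:
  assumes "solves w P D" "reached P D s M" "reached P D s' M'" "q \<in> queries P"
    and "answers P s q \<inter> answers P s' q = {}"
  shows "query_time P D \<ge> 1"
proof -
  let ?C = "query_cells (query_of D q) M"
  have "answer (query_of D q) M \<noteq> answer (query_of D q) M'"
    using reached_answer[OF assms(1,2,4)] reached_answer[OF assms(1,3,4)] assms(5) by force
  then have "?C \<noteq> {}" using answer_cong[of "query_of D q" M M'] by blast
  moreover have "?C \<subseteq> {1..2 ^ w}"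
    using assms reached_memories query_cells_subset by (metis solves_def)
  then have "finite ?C" by (rule finite_subset) simp
  ultimately have "card ?C \<ge> 1" by (simp add: Suc_le_eq card_gt_0_iff)
  with card_query_cells_le[OF assms(1,2,4)] show ?thesis by simp
qed

text \<open>An update without probes leaves the memory unchanged, so no query could notice
  it.\<close>

lemma update_time_pos:
  assumes "solves w P D" "reached P D s M" "u \<in> updates P s" "q \<in> queries P"
    and "answers P s q \<inter> answers P (effect P s u) q = {}"
  shows "update_time P D \<ge> 1"
proof -
  let ?C = "update_cells (update_of D u) M"
  have "answer (query_of D q) M \<noteq> answer (query_of D q) (exec (update_of D u) M)"
    using reached_answer[OF assms(1,2,4)]
      reached_answer[OF assms(1) reached.step[OF assms(2,3)] assms(4)] assms(5)
    by (metis disjoint_iff)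
  moreover have "exec (update_of D u) M = M" if "?C = {}"
    by (rule ext) (simp add: exec_outside_update_cells that)
  ultimately have "?C \<noteq> {}" by metis
  moreover have "?C \<subseteq> {1..2 ^ w}" by (rule reached_update_cells_subset[OF assms(1-3)])
  then have "finite ?C" by (rule finite_subset) simp
  ultimately have "card ?C \<ge> 1" by (simp add: Suc_le_eq card_gt_0_iff)
  with card_update_cells_le[OF assms(1-3)] show ?thesis by simp
qed

section \<open>The encoding argument\<close>

text \<open>Padding by repetition gives all update records the same length, so that the codes below
  form a product of known cardinality.\<close>

lemma ex_list_of_length_covering:
  assumes "A \<subseteq> B" "finite B" "B \<noteq> {}" "card A \<le> t"
  shows "\<exists>xs. length xs = t \<and> A \<subseteq> set xs \<and> set xs \<subseteq> B"
proof -
  obtain b where b: "b \<in> B" using assms(3) by blast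
  have "finite A" using assms(1,2) by (rule finite_subset)
  then obtain ys where ys: "set ys = A" "distinct ys" by (metis finite_distinct_list)
  then have "length ys \<le> t" using assms(4) distinct_card[of ys] by simp
  with ys b assms(1) show ?thesis
    by (intro exI[of _ "ys @ replicate (t - length ys) b"]) (simp add: set_replicate_conv_if)
qed

text \<open>The \<open>k\<close> sets are read as one relation \<open>X\<close>. Only the existence
  of a memory for \<open>st X\<close> is required, so the cost of reaching that state does not enter
  the bound.\<close>

lemma multiphase_bound:
  fixes uf :: "nat \<Rightarrow> 'u" and qf :: "nat \<Rightarrow> 'q"
  assumes sol: "solves w P D" and nonad: "nonadaptive_queries w P D"
    and ex_mem: "\<And>X. X \<subseteq> {..<k} \<times> {..<m} \<Longrightarrow> \<exists>M. reached P D (st X) M"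
    and upd: "\<And>X j. X \<subseteq> {..<k} \<times> {..<m} \<Longrightarrow> j < m \<Longrightarrow> uf j \<in> updates P (st X)"
    and qry: "\<And>i. i < k \<Longrightarrow> qf i \<in> queries P"
    and dist: "\<And>X X' i j. X \<subseteq> {..<k} \<times> {..<m} \<Longrightarrow> X' \<subseteq> {..<k} \<times> {..<m} \<Longrightarrow>
      (i, j) \<in> X \<Longrightarrow> (i, j) \<notin> X' \<Longrightarrow>
      answers P (effect P (st X) (uf j)) (qf i) \<inter> answers P (effect P (st X') (uf j)) (qf i) = {}"
  shows "k * m \<le> w * (k * query_time P D + 2 * m * update_time P D)"
proof -
  define F where "F = Pow ({..<k} \<times> {..<m})"
  define tq where "tq = query_time P D"
  define tu where "tu = update_time P D"
  \<comment> \<open>A state may be reached with several memories, depending on its history; one is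
    fixed for each \<open>X\<close>.\<close>
  obtain mem where mem: "\<And>X. X \<in> F \<Longrightarrow> reached P D (st X) (mem X)"
    using ex_mem unfolding F_def by (metis Pow_iff)
  define mem' where "mem' X j = exec (update_of D (uf j)) (mem X)" for X j
  have mem': "reached P D (effect P (st X) (uf j)) (mem' X j)" if "X \<in> F" "j < m" for X j
    unfolding mem'_def using that mem upd by (intro reached.step) (auto simp: F_def)
  \<comment> \<open>Defined through the memory of the empty relation; by non-adaptivity
    (\<open>cells\<close> below) every reached memory yields the same set.\<close>
  define R where "R = (\<Union>i<k. query_cells (query_of D (qf i)) (mem {}))"
  have emp: "{} \<in> F" by (simp add: F_def)
  have cells: "query_cells (query_of D (qf i)) M = query_cells (query_of D (qf i)) (mem {})"
    if "i < k" "reached P D s M" for i s M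
    using nonad that qry reached_memories[OF sol] mem[OF emp]
    unfolding nonadaptive_queries_def by blast
  have R_sub: "R \<subseteq> {1..2 ^ w}"
    unfolding R_def using qry sol reached_memories[OF sol mem[OF emp]] query_cells_subset
    by (metis (no_types, lifting) UN_least lessThan_iff solves_def)
  then have fin_R: "finite R" using finite_subset by blast
  have card_R: "card R \<le> k * tq"
  proof -
    have "card R \<le> (\<Sum>i<k. card (query_cells (query_of D (qf i)) (mem {})))"
      unfolding R_def by (rule card_UN_le) simp
    also have "\<dots> \<le> (\<Sum>i<k. tq)"
      unfolding tq_def using card_query_cells_le[OF sol mem[OF emp]] qry by (intro sum_mono) auto
    finally show ?thesis by simp
  qed
  have "\<exists>xs. length xs = tu \<and> update_cells (update_of D (uf j)) (mem X) \<subseteq> set xs \<and>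
      set xs \<subseteq> {1..2 ^ w}" if "X \<in> F" "j < m" for X j
  proof -
    have u: "uf j \<in> updates P (st X)" using that upd by (simp add: F_def)
    show ?thesis
      using reached_update_cells_subset[OF sol mem[OF that(1)] u]
        card_update_cells_le[OF sol mem[OF that(1)] u]
      unfolding tu_def by (intro ex_list_of_length_covering) auto
  qed
  then obtain adr where adr: "\<And>X j. X \<in> F \<Longrightarrow> j < m \<Longrightarrow> length (adr X j) = tu \<and>
      update_cells (update_of D (uf j)) (mem X) \<subseteq> set (adr X j) \<and> set (adr X j) \<subseteq> {1..2 ^ w}"
    by metis
  \<comment> \<open>The record holds the final contents of all probed cells, even of those only
    read. The addresses belong to it because an adaptive update may choose them depending on
    \<open>X\<close>.\<close>
  define W where "W X j = map (\<lambda>a. (a, mem' X j a)) (adr X j)" for X j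
  define enc where "enc X = (restrict (mem X) R, restrict (W X) {..<m})" for X
  define Words where "Words = {1..2 ^ w :: nat} \<times> {..<2 ^ w :: nat}"
  define Codes where "Codes =
    (R \<rightarrow>\<^sub>E {..<2 ^ w :: nat}) \<times> ({..<m} \<rightarrow>\<^sub>E {xs. set xs \<subseteq> Words \<and> length xs = tu})"
  have "inj_on enc F"
  proof (rule inj_onI, rule ccontr)
    fix X X' assume X: "X \<in> F" "X' \<in> F" and eq: "enc X = enc X'" and "X \<noteq> X'"
    then obtain i j where ij: "(i, j) \<in> X \<and> (i, j) \<notin> X' \<or> (i, j) \<in> X' \<and> (i, j) \<notin> X"
      by auto
    then have lt: "i < k" "j < m" using X by (auto simp: F_def)
    have 1: "mem X a = mem X' a" if "a \<in> R" for a
      using eq that unfolding enc_def by (metis Pair_inject restrict_apply')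
    have W: "W X j = W X' j"
      using eq lt unfolding enc_def by (metis Pair_inject lessThan_iff restrict_apply')
    \<comment> \<open>Equal records list equal addresses, so the cells outside this common list are
      untouched in both runs.\<close>
    have "map fst (W X j) = adr X j" "map fst (W X' j) = adr X' j"
      by (simp_all add: W_def comp_def)
    with W have same_adr: "adr X j = adr X' j" by simp
    \<comment> \<open>A listed cell has its final contents in the record; an unlisted cell of
      \<open>R\<close> keeps its old contents, which the first component of the code stores.\<close>
    have "mem' X j a = mem' X' j a" if "a \<in> R" for a
    proof (cases "a \<in> set (adr X j)")
      case True
      then show ?thesis using W unfolding W_def same_adr by auto
    next
      case False
      then have "mem' X j a = mem X a" "mem' X' j a = mem X' a"
        unfolding mem'_def using adr X lt same_adr
        by (metis exec_outside_update_cells subsetD)+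
      with 1 that show ?thesis by simp
    qed
    moreover have "query_cells (query_of D (qf i)) (mem' X j) \<subseteq> R"
      using cells[OF lt(1) mem'[OF X(1) lt(2)]] lt(1) unfolding R_def by auto
    ultimately have "answer (query_of D (qf i)) (mem' X j) = answer (query_of D (qf i)) (mem' X' j)"
      by (intro answer_cong) auto
    moreover have "answer (query_of D (qf i)) (mem' Y j) \<in> answers P (effect P (st Y) (uf j)) (qf i)"
      if "Y \<in> F" for Y
      by (rule reached_answer[OF sol mem'[OF that lt(2)] qry[OF lt(1)]])
    ultimately have "answers P (effect P (st X) (uf j)) (qf i) \<inter>
        answers P (effect P (st X') (uf j)) (qf i) \<noteq> {}"
      using X by (metis IntI empty_iff)
    with ij dist[of X X' i j] dist[of X' X i j] X show False by (auto simp: F_def)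
  qed
  moreover have "enc ` F \<subseteq> Codes"
  proof (rule image_subsetI)
    fix X assume X: "X \<in> F"
    have "mem X a < 2 ^ w" if "a \<in> R" for a
      using reached_memories[OF sol mem[OF X]] R_sub that by (auto simp: memories_def)
    moreover have "W X j \<in> {xs. set xs \<subseteq> Words \<and> length xs = tu}" if "j < m" for j
    proof -
      have "mem' X j \<in> memories w" by (rule reached_memories[OF sol mem'[OF X that]])
      then have "mem' X j a < 2 ^ w" if "a \<in> {1..2 ^ w}" for a
        using that by (auto simp: memories_def)
      then show ?thesis using adr[OF X that] by (auto simp: W_def Words_def)
    qed
    ultimately show "enc X \<in> Codes"
      unfolding enc_def Codes_def by (simp add: restrict_PiE_iff)
  qed
  moreover have fin_W: "finite Words" by (simp add: Words_def)
  then have "finite Codes"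
    unfolding Codes_def using fin_R by (intro finite_cartesian_product finite_PiE finite_lists_length_eq) auto
  ultimately have "card F \<le> card Codes" by (metis card_inj_on_le)
  \<comment> \<open>Each recorded cell costs \<open>w\<close> bits for the address and
    \<open>w\<close> for the contents, whence the factor 2 of the bound.\<close>
  also have "card Codes = (2 ^ w) ^ card R * (((2 ^ w * 2 ^ w) ^ tu) ^ m)"
    using fin_W fin_R
    by (simp add: Codes_def card_cartesian_product card_PiE card_lists_length_eq Words_def)
  also have "\<dots> = 2 ^ (w * card R + 2 * w * tu * m)"
    by (simp add: power_add power_mult power2_eq_square flip: power_mult_distrib)
  also have "card F = 2 ^ (k * m)"
    by (simp add: F_def card_Pow card_cartesian_product)
  finally have "k * m \<le> w * card R + 2 * w * tu * m" by simp
  also have "\<dots> \<le> w * (k * tq) + 2 * w * tu * m" using card_R by simp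
  finally show ?thesis by (simp add: tq_def tu_def algebra_simps)
qed

text \<open>Both graph problems use \<open>k = m = (n - 1) div 2\<close>, which leaves one node
  beyond the two layers. Cancelling \<open>k\<close> gives a bound linear in \<open>n\<close>. For
  \<open>n\<close> at most 2 this \<open>k\<close> is 0, and a single probe has to suffice
  instead.\<close>

lemma times_linear_of_square_bound:
  fixes n w tq tu :: nat
  assumes "w \<ge> 1" and "n \<ge> 1 \<Longrightarrow> n \<le> 2 \<Longrightarrow> tq \<ge> 1"
    and "n \<ge> 3 \<Longrightarrow> (n - 1) div 2 * ((n - 1) div 2) \<le>
      w * ((n - 1) div 2 * tq + 2 * ((n - 1) div 2) * tu)"
  shows "real tq \<ge> 1 / 12 * (real n / real w) \<or> real tu \<ge> 1 / 12 * (real n / real w)"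
proof -
  have "n \<le> 4 * (w * (tq + 2 * tu))"
  proof (cases "n \<ge> 3")
    case True
    define k where "k = (n - 1) div 2"
    with True have "k \<ge> 1" "n \<le> 2 * k + 2" by auto
    then have "n \<le> 4 * k" by linarith
    have "k * k \<le> k * (w * (tq + 2 * tu))"
      using assms(3)[OF True, folded k_def] by (simp add: algebra_simps)
    with \<open>k \<ge> 1\<close> have "k \<le> w * (tq + 2 * tu)" by simp
    with \<open>n \<le> 4 * k\<close> show ?thesis by linarith
  next
    case False
    have "n = 0 \<or> w * (tq + 2 * tu) \<ge> 1 * 1"
      using assms(1,2) False by (cases "n = 0") (simp, intro disjI2 mult_le_mono, auto)
    with False show ?thesis by linarith
  qed
  then have "n \<le> 4 * (tq * w + 2 * (tu * w))" by (simp add: algebra_simps)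
  \<comment> \<open>If \<open>a\<close> and \<open>b\<close> were both below n/12, then 4(a + 2b)
    would be below n.\<close>
  moreover have "n \<le> 12 * a \<or> n \<le> 12 * b" if "n \<le> 4 * (a + 2 * b)" for a b
    using that by arith
  ultimately have "n \<le> 12 * (tq * w) \<or> n \<le> 12 * (tu * w)" by blast
  then have "real n \<le> real (12 * (tq * w)) \<or> real n \<le> real (12 * (tu * w))"
    by (simp only: of_nat_le_iff)
  with assms(1) show ?thesis by (simp add: field_simps)
qed

section \<open>Reachability\<close>

text \<open>The bipartite graph of \<open>X\<close> with layers 1, ..., k and k + 1, ..., k + m. In
  its uses node \<open>n\<close> lies beyond both layers and is isolated until the update.\<close>

definition layered :: "nat \<Rightarrow> (nat \<times> nat) set \<Rightarrow> (nat \<times> nat) set" where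
  "layered k X = (\<lambda>(i, j). (i + 1, k + 1 + j)) ` X"

text \<open>The inserted edge is the only one into \<open>n\<close>, so a path from the first layer
  must cross to exactly the node \<open>k + 1 + j\<close>.\<close>

lemma layered_reachable_iff:
  assumes "X \<subseteq> {..<k} \<times> {..<m}" "k + m < n" "i < k" "j < m"
  shows "(i + 1, n) \<in> (insert (k + 1 + j, n) (layered k X))\<^sup>* \<longleftrightarrow> (i, j) \<in> X" (is "_ \<in> ?E\<^sup>* \<longleftrightarrow> _")
proof
  assume "(i, j) \<in> X"
  then have "(i + 1, k + 1 + j) \<in> ?E" by (force simp: layered_def)
  moreover have "(k + 1 + j, n) \<in> ?E" by simp
  ultimately show "(i + 1, n) \<in> ?E\<^sup>*" by (meson r_into_rtrancl rtrancl.rtrancl_into_rtrancl)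
next
  assume "(i + 1, n) \<in> ?E\<^sup>*"
  then obtain y where y: "(i + 1, y) \<in> ?E" "(y, n) \<in> ?E\<^sup>*"
    using assms by (auto elim: converse_rtranclE)
  then obtain j' where j': "y = k + 1 + j'" "(i, j') \<in> X"
    using assms by (auto simp: layered_def)
  then have "y \<noteq> n" using assms by auto
  \<comment> \<open>The only edge that leaves the second layer is the inserted one, so moving on
    from \<open>y\<close> forces \<open>j' = j\<close>.\<close>
  with y(2) obtain z where "(y, z) \<in> ?E" by (auto elim: converse_rtranclE)
  then have "j' = j" using j' assms by (auto simp: layered_def)
  with j' show "(i, j) \<in> X" by simp
qed

lemma reachability_bound:
  assumes "n \<ge> 2" "w \<ge> 1" and sol: "solves w (reachability n) D"
    and nonad: "nonadaptive_queries w (reachability n) D"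
  shows "real (query_time (reachability n) D) \<ge> 1 / 12 * (real n / real w) \<or>
    real (update_time (reachability n) D) \<ge> 1 / 12 * (real n / real w)"
proof (rule times_linear_of_square_bound)
  let ?P = "reachability n" and ?k = "(n - 1) div 2"
  show "?k * ?k \<le> w * (?k * query_time ?P D + 2 * ?k * update_time ?P D)" if "n \<ge> 3"
  proof (rule multiphase_bound[OF sol nonad,
        where st = "layered ?k" and uf = "\<lambda>j. (?k + 1 + j, n)" and qf = "\<lambda>i. (i + 1, n)"])
    have le: "?k + ?k < n" using that by auto
    fix X assume X: "X \<subseteq> {..<?k} \<times> {..<?k}"
    have "layered ?k X \<in> inputs ?P"
      using X le by (auto simp: layered_def reachability_def irrefl_def)
    then show "\<exists>M. reached ?P D (layered ?k X) M" using reached.start by metis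
    show "(?k + 1 + j, n) \<in> updates ?P (layered ?k X)" if "j < ?k" for j
      using X le that by (auto simp: layered_def reachability_def)
    fix X' i j assume X': "X' \<subseteq> {..<?k} \<times> {..<?k}" "(i, j) \<in> X" "(i, j) \<notin> X'"
    then have "i < ?k" "j < ?k" using X by auto
    then show "answers ?P (effect ?P (layered ?k X) (?k + 1 + j, n)) (i + 1, n) \<inter>
        answers ?P (effect ?P (layered ?k X') (?k + 1 + j, n)) (i + 1, n) = {}"
      using layered_reachable_iff[OF X le] layered_reachable_iff[OF X'(1) le] X'(2,3)
      by (simp add: reachability_def)
  qed (use that in \<open>auto simp: reachability_def\<close>)
  \<comment> \<open>For \<open>n = 2\<close>: inserting the edge (1, 2) into the empty graph changes
    the answer to the query (1, 2). With a single node all answers would be constant and no probe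
    necessary.\<close>
  have start: "reached ?P D {} (preprocess D {})"
    by (rule reached.start) (simp add: reachability_def irrefl_def)
  have u: "(1, 2) \<in> updates ?P {}" using assms(1) by (simp add: reachability_def)
  show "query_time ?P D \<ge> 1"
    using assms(1)
    by (intro query_time_pos[OF sol start reached.step[OF start u], where q = "(1, 2)"])
      (auto simp: reachability_def)
qed (use assms in auto)

section \<open>Subgraph connectivity\<close>

text \<open>Toggling the nodes in which \<open>S\<close> differs from the initial on-set, one at a
  time, leads to \<open>S\<close>. The induction is on the set \<open>T\<close> of nodes toggled so
  far.\<close>

lemma reached_subgraph_connectivity:
  assumes "E \<subseteq> {1..n} \<times> {1..n}" "irrefl E" "sym E" "S\<^sub>0 \<subseteq> {1..n}" "S \<subseteq> {1..n}"
  shows "\<exists>M. reached (subgraph_connectivity n S\<^sub>0) D (E, S) M"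
proof -
  let ?P = "subgraph_connectivity n S\<^sub>0"
  have "\<exists>M. reached ?P D (E, (S\<^sub>0 - T) \<union> (T - S\<^sub>0)) M" if "finite T" "T \<subseteq> {1..n}" for T
    using that
  proof (induction T rule: finite_induct)
    case empty
    have "(E, S\<^sub>0) \<in> inputs ?P" using assms by (simp add: subgraph_connectivity_def)
    then show ?case using reached.start by fastforce
  next
    case (insert v T)
    then obtain M where M: "reached ?P D (E, (S\<^sub>0 - T) \<union> (T - S\<^sub>0)) M" by auto
    \<comment> \<open>As \<open>v\<close> has not been toggled yet, its status is still the initial
      one, so this update is a permitted toggle.\<close>
    have "(v, v \<notin> S\<^sub>0) \<in> updates ?P (E, (S\<^sub>0 - T) \<union> (T - S\<^sub>0))"
      using insert by (auto simp: subgraph_connectivity_def)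
    from reached.step[OF M this]
    have "\<exists>M. reached ?P D (effect ?P (E, (S\<^sub>0 - T) \<union> (T - S\<^sub>0)) (v, v \<notin> S\<^sub>0)) M" by blast
    moreover have "effect ?P (E, (S\<^sub>0 - T) \<union> (T - S\<^sub>0)) (v, v \<notin> S\<^sub>0) =
        (E, (S\<^sub>0 - insert v T) \<union> (insert v T - S\<^sub>0))"
      using insert by (auto simp: subgraph_connectivity_def)
    ultimately show ?case by simp
  qed
  moreover have "(S\<^sub>0 - T) \<union> (T - S\<^sub>0) = S" if "T = (S\<^sub>0 - S) \<union> (S - S\<^sub>0)" for T
    using that by auto
  moreover have "(S\<^sub>0 - S) \<union> (S - S\<^sub>0) \<subseteq> {1..n}" using assms by auto
  ultimately show ?thesis by (metis finite_atLeastAtMost finite_subset)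
qed

text \<open>Updates cannot add edges here, so all edges to \<open>n\<close> are present from the
  start; turning on a second-layer node takes the place of inserting its edge.\<close>

definition layered_sym :: "nat \<Rightarrow> nat \<Rightarrow> nat \<Rightarrow> (nat \<times> nat) set \<Rightarrow> (nat \<times> nat) set" where
  "layered_sym n k m X = (let E = layered k X \<union> (\<lambda>j. (k + 1 + j, n)) ` {..<m} in E \<union> E\<inverse>)"

text \<open>All neighbours of a first-layer node lie in the second layer, where only
  \<open>k + 1 + j\<close> is on. Hence the first edge of a path already reveals the bit.\<close>

lemma layered_sym_connected_iff:
  assumes "X \<subseteq> {..<k} \<times> {..<m}" "k + m < n" "i < k" "j < m"
  defines "S \<equiv> insert (k + 1 + j) (insert n {1..k})"
  shows "(i + 1, n) \<in> (Restr (layered_sym n k m X) S)\<^sup>* \<longleftrightarrow> (i, j) \<in> X" (is "_ \<in> ?E\<^sup>* \<longleftrightarrow> _")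
proof
  assume "(i, j) \<in> X"
  then have "(i + 1, k + 1 + j) \<in> ?E"
    using assms(3) by (force simp: layered_sym_def layered_def S_def Let_def)
  moreover have "(k + 1 + j, n) \<in> ?E"
    using assms(4) by (auto simp: layered_sym_def S_def Let_def)
  ultimately show "(i + 1, n) \<in> ?E\<^sup>*" by (meson r_into_rtrancl rtrancl.rtrancl_into_rtrancl)
next
  assume "(i + 1, n) \<in> ?E\<^sup>*"
  then obtain y where y: "(i + 1, y) \<in> ?E"
    using assms(2,3) by (auto elim: converse_rtranclE)
  then show "(i, j) \<in> X"
    using assms(1-4) by (auto simp: layered_sym_def layered_def S_def Let_def)
qed

lemma subgraph_connectivity_bound:
  assumes "S\<^sub>0 \<subseteq> {1..n}" "w \<ge> 1" and sol: "solves w (subgraph_connectivity n S\<^sub>0) D"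
    and nonad: "nonadaptive_queries w (subgraph_connectivity n S\<^sub>0) D"
  shows "real (query_time (subgraph_connectivity n S\<^sub>0) D) \<ge> 1 / 12 * (real n / real w) \<or>
    real (update_time (subgraph_connectivity n S\<^sub>0) D) \<ge> 1 / 12 * (real n / real w)"
proof (rule times_linear_of_square_bound)
  let ?P = "subgraph_connectivity n S\<^sub>0" and ?k = "(n - 1) div 2"
  let ?st = "\<lambda>X. (layered_sym n ?k ?k X, insert n {1..?k})"
  show "?k * ?k \<le> w * (?k * query_time ?P D + 2 * ?k * update_time ?P D)" if "n \<ge> 3"
  proof (rule multiphase_bound[OF sol nonad, where st = ?st
        and uf = "\<lambda>j. (?k + 1 + j, True)" and qf = "\<lambda>i. (i + 1, n)"])
    have le: "?k + ?k < n" using that by auto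
    fix X assume X: "X \<subseteq> {..<?k} \<times> {..<?k}"
    show "\<exists>M. reached ?P D (?st X) M"
    proof (rule reached_subgraph_connectivity)
      show "layered_sym n ?k ?k X \<subseteq> {1..n} \<times> {1..n}"
        using X le by (auto simp: layered_sym_def layered_def Let_def)
      show "irrefl (layered_sym n ?k ?k X)"
        using X le by (auto simp: layered_sym_def layered_def Let_def irrefl_def)
      show "sym (layered_sym n ?k ?k X)"
        by (auto simp: layered_sym_def Let_def sym_def)
    qed (use assms(1) that in auto)
    show "(?k + 1 + j, True) \<in> updates ?P (?st X)" if "j < ?k" for j
      using le that by (auto simp: subgraph_connectivity_def)
    fix X' i j assume X': "X' \<subseteq> {..<?k} \<times> {..<?k}" "(i, j) \<in> X" "(i, j) \<notin> X'"
    then have "i < ?k" "j < ?k" using X by auto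
    then show "answers ?P (effect ?P (?st X) (?k + 1 + j, True)) (i + 1, n) \<inter>
        answers ?P (effect ?P (?st X') (?k + 1 + j, True)) (i + 1, n) = {}"
      using layered_sym_connected_iff[OF X le] layered_sym_connected_iff[OF X'(1) le] X'(2,3)
      by (simp add: subgraph_connectivity_def)
  qed (use that in \<open>auto simp: subgraph_connectivity_def\<close>)
  \<comment> \<open>Node 1 is connected to itself exactly when it is on, so a single node already
    yields two different answers.\<close>
  show "query_time ?P D \<ge> 1" if "n \<ge> 1"
  proof -
    have "irrefl ({} :: (nat \<times> nat) set)" "sym ({} :: (nat \<times> nat) set)"
      by (simp_all add: irrefl_def sym_def)
    then have ex: "\<exists>M. reached ?P D ({}, S) M" if "S \<subseteq> {1..n}" for S
      using assms(1) that by (intro reached_subgraph_connectivity) auto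
    obtain M where M: "reached ?P D ({}, {}) M" using ex[of "{}"] by auto
    obtain M' where M': "reached ?P D ({}, {1}) M'" using ex[of "{1}"] \<open>n \<ge> 1\<close> by auto
    show ?thesis
      using \<open>n \<ge> 1\<close>
      by (intro query_time_pos[OF sol M M', where q = "(1, 1)"])
        (auto simp: subgraph_connectivity_def)
  qed
qed (use assms in auto)

section \<open>Range mode\<close>

text \<open>
  Block \<open>i\<close> of \<open>mode_val\<close> lists one element of each pair \<open>{2 j, 2 j + 1}\<close>, the choice being the
  bit \<open>(i, j)\<close> of \<open>X\<close>, and then the others; selecting exactly one per pair makes the border
  between the two halves independent of \<open>X\<close>. The array contains each entry twice, in reverse
  order, in front of a last entry that the update sets to \<open>x = 2 j + 1\<close>. The doubling avoids ties:
  on the query that starts at the border of block \<open>i\<close>, the element chosen by block \<open>i\<close> from a pair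
  occurs \<open>2 i + 2\<close> times and the other one \<open>2 i\<close> times, apart from the single additional
  occurrence of \<open>x\<close>.
\<close>

definition mode_val :: "nat \<Rightarrow> (nat \<times> nat) set \<Rightarrow> nat \<Rightarrow> nat" where
  "mode_val m X e = (let i = e div (2 * m); r = e mod (2 * m) in
    if r < m then 2 * r + of_bool ((i, r) \<in> X) else 2 * (r - m) + of_bool ((i, r - m) \<notin> X))"

definition mode_array :: "nat \<Rightarrow> nat \<Rightarrow> (nat \<times> nat) set \<Rightarrow> nat \<Rightarrow> int" where
  "mode_array n m X p =
    (if p \<in> {1..<n} then int (mode_val m X ((n - 1 - p) div 2)) else if p = n then 0 else undefined)"

section \<open>Occurrence counts in the range mode array\<close>

lemma mode_val_less: "m > 0 \<Longrightarrow> mode_val m X e < 2 * m"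
proof -
  assume "m > 0"
  then have "e mod (2 * m) < 2 * m" by simp
  then show ?thesis by (auto simp: mode_val_def Let_def)
qed

lemma mode_val_block:
  assumes "r < 2 * m"
  shows "mode_val m X (2 * m * i + r) =
    (if r < m then 2 * r + of_bool ((i, r) \<in> X) else 2 * (r - m) + of_bool ((i, r - m) \<notin> X))"
  using assms by (simp add: mode_val_def)

text \<open>Offset \<open>j\<close> of either half holds one element of the pair \<open>j\<close>,
  so each value below \<open>2 * m\<close> occurs exactly once in a block, and \<open>X\<close> only
  decides in which half.\<close>

lemma mode_val_eq_iff:
  assumes "r < 2 * m" "j < m"
  shows "mode_val m X (2 * m * i + r) = 2 * j + of_bool b \<longleftrightarrow>
    r = (if b \<longleftrightarrow> (i, j) \<in> X then j else m + j)"
proof -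
  have eq: "2 * x + of_bool c = 2 * j + of_bool b \<longleftrightarrow> x = j \<and> (c \<longleftrightarrow> b)" for x :: nat and c
    by (cases c; cases b; simp; presburger)
  show ?thesis
  proof (cases "r < m")
    case True
    then have "mode_val m X (2 * m * i + r) = 2 * r + of_bool ((i, r) \<in> X)"
      using mode_val_block[OF assms(1)] by simp
    then show ?thesis using True by (auto simp only: eq split: if_split)
  next
    case False
    then have "mode_val m X (2 * m * i + r) = 2 * (r - m) + of_bool ((i, r - m) \<notin> X)"
      using mode_val_block[OF assms(1)] by simp
    moreover have "r - m = j \<longleftrightarrow> r = m + j" "r \<noteq> j" using False assms(2) by auto
    ultimately show ?thesis by (auto simp only: eq split: if_split)
  qed
qed

text \<open>Every complete block contributes each value once, whatever \<open>X\<close> is.\<close>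

lemma card_mode_val_blocks:
  assumes "j < m"
  shows "card {e. e < 2 * m * i \<and> mode_val m X e = 2 * j + of_bool b} = i"
proof (induction i)
  case (Suc i)
  let ?A = "\<lambda>i. {e. e < 2 * m * i \<and> mode_val m X e = 2 * j + of_bool b}"
  let ?e = "2 * m * i + (if b \<longleftrightarrow> (i, j) \<in> X then j else m + j)"
  have "?A (Suc i) = insert ?e (?A i)"
  proof (intro set_eqI)
    fix e
    show "e \<in> ?A (Suc i) \<longleftrightarrow> e \<in> insert ?e (?A i)"
    proof (cases "e < 2 * m * i")
      case True
      then show ?thesis by auto
    next
      case False
      then obtain r where r: "e = 2 * m * i + r" using le_Suc_ex not_less by blast
      show ?thesis
      proof (cases "r < 2 * m")
        case True
        then show ?thesis
          using mode_val_eq_iff[OF True assms, of X i b] unfolding r by simp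
      next
        case False
        then show ?thesis using assms by (auto simp: r)
      qed
    qed
  qed
  then show ?case using Suc by simp
qed simp

text \<open>Beyond the complete blocks, the first half of block \<open>i\<close> contributes
  precisely the chosen element of each pair.\<close>

lemma card_mode_val:
  assumes "j < m"
  shows "card {e. e < 2 * m * i + m \<and> mode_val m X e = 2 * j + of_bool b} =
    i + of_bool (b \<longleftrightarrow> (i, j) \<in> X)"
proof -
  define A where "A = {e. e < 2 * m * i \<and> mode_val m X e = 2 * j + of_bool b}"
  have "{e. e < 2 * m * i + m \<and> mode_val m X e = 2 * j + of_bool b} =
    (if b \<longleftrightarrow> (i, j) \<in> X then insert (2 * m * i + j) A else A)" (is "?B = ?C")
  proof (intro set_eqI)
    fix e
    show "e \<in> ?B \<longleftrightarrow> e \<in> ?C"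
    proof (cases "e < 2 * m * i")
      case True
      then show ?thesis by (auto simp: A_def)
    next
      case False
      then obtain r where r: "e = 2 * m * i + r" using le_Suc_ex not_less by blast
      show ?thesis
      proof (cases "r < m")
        case True
        then have "r < 2 * m" by simp
        then show ?thesis
          using mode_val_eq_iff[OF _ assms, of r X i b] True unfolding r A_def by auto
      next
        case False
        then show ?thesis using assms by (auto simp: r A_def)
      qed
    qed
  qed
  moreover have "card A = i" unfolding A_def by (rule card_mode_val_blocks[OF assms])
  moreover have "finite A" "2 * m * i + j \<notin> A" by (simp_all add: A_def)
  ultimately show ?thesis by simp
qed

text \<open>Because of the reverse order, a suffix of the array corresponds to a prefix of the list;
  entry \<open>N\<close> sits at positions \<open>n - 2 * N - 2\<close> and
  \<open>n - 2 * N - 1\<close>.\<close>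

lemma card_mode_array_doubled:
  assumes "2 * N < n"
  shows "card {p \<in> {n - 2 * N..<n}. mode_array n m X p = int b} =
    2 * card {e. e < N \<and> mode_val m X e = b}"
  using assms
proof (induction N)
  case (Suc N)
  let ?A = "\<lambda>N. {p \<in> {n - 2 * N..<n}. mode_array n m X p = int b}"
  let ?B = "\<lambda>N. {e. e < N \<and> mode_val m X e = b}"
  let ?p = "n - 2 * N - 2" and ?p' = "n - 2 * N - 1"
  have v: "mode_array n m X ?p = int (mode_val m X N)" "mode_array n m X ?p' = int (mode_val m X N)"
    using Suc.prems by (auto simp: mode_array_def)
  have "{n - 2 * Suc N..<n} = insert ?p (insert ?p' {n - 2 * N..<n})"
    using Suc.prems by auto
  then have A: "?A (Suc N) = (if mode_val m X N = b then insert ?p (insert ?p' (?A N)) else ?A N)"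
    using v by auto
  have "?p' \<notin> ?A N" "?p \<notin> insert ?p' (?A N)" using Suc.prems by auto
  then have "card (?A (Suc N)) = card (?A N) + 2 * of_bool (mode_val m X N = b)"
    unfolding A by simp
  moreover have "?B (Suc N) = (if mode_val m X N = b then insert N (?B N) else ?B N)"
    by (auto simp: less_Suc_eq)
  then have "card (?B (Suc N)) = card (?B N) + of_bool (mode_val m X N = b)" by simp
  ultimately show ?case using Suc by simp
qed simp

lemma card_mode_array:
  assumes "2 * (2 * m * i + m) < n" "j < m"
  shows "card {p \<in> {n - 2 * (2 * m * i + m)..n}.
      ((mode_array n m X)(n := x)) p = int (2 * j + of_bool b)} =
    2 * (i + of_bool (b \<longleftrightarrow> (i, j) \<in> X)) + of_bool (x = int (2 * j + of_bool b))"
proof -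
  let ?N = "2 * m * i + m" and ?v = "2 * j + of_bool b"
  let ?A = "{p \<in> {n - 2 * ?N..<n}. mode_array n m X p = int ?v}"
  have "{p \<in> {n - 2 * ?N..n}. ((mode_array n m X)(n := x)) p = int ?v} =
      (if x = int ?v then insert n ?A else ?A)" by auto
  then have "card {p \<in> {n - 2 * ?N..n}. ((mode_array n m X)(n := x)) p = int ?v} =
      card ?A + of_bool (x = int ?v)" by simp
  then show ?thesis
    unfolding card_mode_array_doubled[OF assms(1)] card_mode_val[OF assms(2)] by simp
qed

text \<open>If the bit is set, \<open>2 * j + 1\<close> occurs 2i + 3 times and every other value at
  most 2i + 2 times. Otherwise it occurs 2i + 1 times and loses to its partner \<open>2 * j\<close>,
  which occurs 2i + 2 times.\<close>

lemma mode_answer_iff: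
  assumes "2 * (2 * m * i + m) < n" "j < m"
    and a: "a \<in> answers (range_mode n Z) ((mode_array n m X)(n := int (2 * j + 1)))
      (n - 2 * (2 * m * i + m), n)"
  shows "a = int (2 * j + 1) \<longleftrightarrow> (i, j) \<in> X"
proof -
  let ?l = "n - 2 * (2 * m * i + m)"
  define A where "A = (mode_array n m X)(n := int (2 * j + 1))"
  define cnt where "cnt = (\<lambda>b. card {p \<in> {?l..n}. A p = b})"
  have cnt: "cnt (int (2 * j' + of_bool b)) = 2 * (i + of_bool (b \<longleftrightarrow> (i, j') \<in> X)) +
      of_bool (int (2 * j + 1) = int (2 * j' + of_bool b))" if "j' < m" for j' b
    unfolding cnt_def A_def by (rule card_mode_array[OF assms(1) that])
  have "is_arg_max cnt (\<lambda>b. b \<in> A ` {?l..n}) a"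
    using a[folded A_def]
    unfolding range_mode_def cnt_def by (simp only: problem.simps prod.case mem_Collect_eq)
  then have a_in: "a \<in> A ` {?l..n}" and a_max: "\<And>b. b \<in> A ` {?l..n} \<Longrightarrow> cnt b \<le> cnt a"
    unfolding is_arg_max_linorder by blast+
  \<comment> \<open>The mode is maximal only among values that occur, so competitors must first be
    shown to occur.\<close>
  have in_image: "b \<in> A ` {?l..n}" if "cnt b > 0" for b
  proof -
    have "{p \<in> {?l..n}. A p = b} \<noteq> {}" using that unfolding cnt_def by (metis card.empty less_irrefl)
    then show ?thesis by auto
  qed
  have "m > 0" using assms(2) by simp
  have "A p \<in> int ` {..<2 * m}" if "p \<in> {?l..n}" for p
  proof (cases "p = n")
    case True
    then have "A p = int (2 * j + 1)" "2 * j + 1 < 2 * m" using assms(2) by (simp_all add: A_def)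
    then show ?thesis by blast
  next
    case False
    then show ?thesis
      using that assms(1) mode_val_less[OF \<open>m > 0\<close>] by (auto simp: A_def mode_array_def)
  qed
  with a_in have "a \<in> int ` {..<2 * m}" by blast
  then obtain y where y: "a = int y" "y < 2 * m" by blast
  define j' b where "j' = y div 2" and "b = odd y"
  have "y = 2 * j' + of_bool b" unfolding j'_def b_def by (cases "odd y") simp_all
  with y have a_eq: "a = int (2 * j' + of_bool b)" and j': "j' < m" by simp_all
  have c1: "cnt (int (2 * j + 1)) = 2 * (i + of_bool ((i, j) \<in> X)) + 1"
    using cnt[OF assms(2), of True] by simp
  show ?thesis
  proof
    assume "(i, j) \<in> X"
    then have c: "cnt (int (2 * j + 1)) = 2 * i + 3" using c1 by simp
    then have "cnt (int (2 * j + 1)) \<le> cnt a" by (intro a_max in_image) simp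
    then have "2 * i + 3 \<le> cnt (int (2 * j' + of_bool b))" using a_eq c by simp
    then show "a = int (2 * j + 1)"
      unfolding a_eq cnt[OF j'] by (auto simp: of_bool_def split: if_splits)
  next
    assume eq: "a = int (2 * j + 1)"
    show "(i, j) \<in> X"
    proof (rule ccontr)
      assume X: "(i, j) \<notin> X"
      have "cnt (int (2 * j + of_bool False)) = 2 * i + 2"
        unfolding cnt[OF assms(2)] using X by simp
      moreover from this have "cnt (int (2 * j + of_bool False)) \<le> cnt a"
        by (intro a_max in_image) simp
      ultimately show False using c1 X eq by simp
    qed
  qed
qed

text \<open>Changing the first entry of the zero array to 1 changes the only mode of the range
  consisting of that entry.\<close>

lemma range_mode_times_pos:
  assumes "{0..int n} \<subseteq> Z" "n \<ge> 1" and sol: "solves w (range_mode n Z) D"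
  shows "query_time (range_mode n Z) D \<ge> 1" "update_time (range_mode n Z) D \<ge> 1"
proof -
  let ?P = "range_mode n Z" and ?u = "(1, 1) :: nat \<times> int" and ?q = "(1, 1) :: nat \<times> nat"
  let ?A = "restrict (\<lambda>_. 0) {1..n} :: nat \<Rightarrow> int"
  have "0 \<in> Z" "1 \<in> Z" using assms(1,2) by auto
  then have "?A \<in> inputs ?P" and u: "?u \<in> updates ?P ?A" and q: "?q \<in> queries ?P"
    using assms(2) by (auto simp: range_mode_def)
  then have r: "reached ?P D ?A (preprocess D ?A)" by (rule_tac reached.start)
  have "answers ?P ?A ?q \<inter> answers ?P (effect ?P ?A ?u) ?q = {}"
    using assms(2) by (auto simp: range_mode_def is_arg_max_def)
  then show "query_time ?P D \<ge> 1" "update_time ?P D \<ge> 1"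
    using query_time_pos[OF sol r reached.step[OF r u] q] update_time_pos[OF sol r u q] by auto
qed

text \<open>The array needs room for \<open>k\<close> blocks of \<open>2 * m\<close> entries, each
  entry twice, and for the last entry; this is \<open>4 * m * k < n\<close>.\<close>

lemma range_mode_multiphase:
  assumes Z: "{0..int n} \<subseteq> Z" and sol: "solves w (range_mode n Z) D"
    and nonad: "nonadaptive_queries w (range_mode n Z) D"
    and "4 * m * k < n" "m > 0" "k > 0"
  shows "k * m \<le> w * (k * query_time (range_mode n Z) D + 2 * m * update_time (range_mode n Z) D)"
proof (rule multiphase_bound[OF sol nonad, where st = "mode_array n m"
      and uf = "\<lambda>j. (n, int (2 * j + 1))" and qf = "\<lambda>i. (n - 2 * (2 * m * i + m), n)"])
  let ?P = "range_mode n Z"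
  have "2 * m \<le> 4 * m * k" using assms(6) by simp
  then have mn: "2 * m < n" using assms(4) by linarith
  have pos: "2 * (2 * m * i + m) < n" if "i < k" for i
  proof -
    have "4 * m * (i + 1) \<le> 4 * m * k" using that by (intro mult_le_mono2) simp
    then have "4 * m * i + 4 * m < n" using assms(4) by simp
    then show ?thesis by simp
  qed
  show "(n - 2 * (2 * m * i + m), n) \<in> queries ?P" if "i < k" for i
    using pos[OF that] by (simp add: range_mode_def)
  have val: "int v \<in> Z" if "v < 2 * m" for v using Z that mn by auto
  fix X
  have "mode_array n m X \<in> inputs ?P"
    using val mode_val_less[OF assms(5)] val[of 0] assms(5) mn
    by (auto simp: range_mode_def mode_array_def)
  then show "\<exists>M. reached ?P D (mode_array n m X) M" using reached.start by metis
  show "(n, int (2 * j + 1)) \<in> updates ?P (mode_array n m X)" if "j < m" for j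
    using val[of "2 * j + 1"] that mn by (simp add: range_mode_def mode_array_def)
  fix X' i j
  assume X: "X \<subseteq> {..<k} \<times> {..<m}" and ij: "(i, j) \<in> X" "(i, j) \<notin> X'"
  then have lt: "i < k" "j < m" by auto
  \<comment> \<open>The last entry is initially 0, so the additive update sets it to
    \<open>2 * j + 1\<close>.\<close>
  have "effect ?P (mode_array n m Y) (n, int (2 * j + 1)) = (mode_array n m Y)(n := int (2 * j + 1))"
    for Y by (simp add: range_mode_def mode_array_def)
  then show "answers ?P (effect ?P (mode_array n m X) (n, int (2 * j + 1)))
        (n - 2 * (2 * m * i + m), n) \<inter>
      answers ?P (effect ?P (mode_array n m X') (n, int (2 * j + 1)))
        (n - 2 * (2 * m * i + m), n) = {}"
    using mode_answer_iff[OF pos[OF lt(1)] lt(2)] ij by (metis disjoint_iff)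
qed

lemma range_mode_bound:
  assumes Z: "{0..int n} \<subseteq> Z" and "w \<ge> 1" and sol: "solves w (range_mode n Z) D"
    and nonad: "nonadaptive_queries w (range_mode n Z) D"
  shows "real (query_time (range_mode n Z) D) * real (update_time (range_mode n Z) D)
    \<ge> 1 / 40 * (real n / (real w)\<^sup>2)"
proof (cases "n = 0")
  case False
  define tq where "tq = query_time (range_mode n Z) D"
  define tu where "tu = update_time (range_mode n Z) D"
  have t: "tq \<ge> 1" "tu \<ge> 1"
    using range_mode_times_pos[OF Z _ sol] False by (auto simp: tq_def tu_def)
  \<comment> \<open>With these values the query term \<open>w * k * tq\<close> is exactly half of
    \<open>k * m\<close>, and the update term \<open>2 * w * m * tu\<close> is strictly less than
    half because of the \<open>+ 1\<close> in \<open>k\<close>. So the encoding bound fails, and the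
    array must be too short for it.\<close>
  define m where "m = 2 * tq * w"
  define k where "k = 4 * tu * w + 1"
  have "m > 0" "k > 0" using t assms(2) by (auto simp: m_def k_def)
  have "n \<le> 4 * m * k"
  proof (rule ccontr)
    assume "\<not> n \<le> 4 * m * k"
    then have "k * m \<le> w * (k * tq + 2 * m * tu)"
      using range_mode_multiphase[OF Z sol nonad _ \<open>m > 0\<close> \<open>k > 0\<close>] by (simp add: tq_def tu_def)
    then have "2 * (k * m) \<le> k * (2 * tq * w) + m * (4 * tu * w)" by (simp add: algebra_simps)
    also have "\<dots> < k * m + m * k" using \<open>m > 0\<close> by (simp add: m_def k_def)
    finally show False by simp
  qed
  \<comment> \<open>As \<open>tu * w\<close> is at least 1, the summand 1 of \<open>k\<close> is
    absorbed into \<open>5 * (tu * w)\<close>; this yields 4 * 2 * 5 = 40.\<close>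
  also have "4 * m * k \<le> 4 * m * (5 * (tu * w))"
    using mult_le_mono[OF t(2) assms(2)] by (intro mult_le_mono2) (simp add: k_def)
  also have "\<dots> = 40 * (tq * tu * w\<^sup>2)" by (simp add: m_def power2_eq_square)
  finally have "real n \<le> real (40 * (tq * tu * w\<^sup>2))" by (rule of_nat_mono)
  then show ?thesis using assms(2) by (simp add: field_simps flip: tq_def tu_def)
qed simp

theorem corollary1:
  "(\<exists>c::real. c > 0 \<and>
      (\<forall>n w D. n \<ge> 2 \<and> w \<ge> 1 \<and>
        solves w (reachability n) D \<and> nonadaptive_queries w (reachability n) D \<longrightarrow>
          real (query_time (reachability n) D) \<ge> c * (real n / real w) \<or>
          real (update_time (reachability n) D) \<ge> c * (real n / real w)))
   \<and>
   (\<exists>c::real. c > 0 \<and>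
      (\<forall>n w S\<^sub>0 D. S\<^sub>0 \<subseteq> {1..n} \<and> w \<ge> 1 \<and>
        solves w (subgraph_connectivity n S\<^sub>0) D \<and>
        nonadaptive_queries w (subgraph_connectivity n S\<^sub>0) D \<longrightarrow>
          real (query_time (subgraph_connectivity n S\<^sub>0) D) \<ge> c * (real n / real w) \<or>
          real (update_time (subgraph_connectivity n S\<^sub>0) D) \<ge> c * (real n / real w)))
   \<and>
   (\<exists>c::real. c > 0 \<and>
      (\<forall>n w Z D. {0..int n} \<subseteq> Z \<and> w \<ge> 1 \<and>
        solves w (range_mode n Z) D \<and> nonadaptive_queries w (range_mode n Z) D \<longrightarrow>
          real (query_time (range_mode n Z) D) * real (update_time (range_mode n Z) D)
            \<ge> c * (real n / (real w)\<^sup>2)))"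
proof (intro conjI)
  show "\<exists>c::real. c > 0 \<and>
      (\<forall>n w D. n \<ge> 2 \<and> w \<ge> 1 \<and>
        solves w (reachability n) D \<and> nonadaptive_queries w (reachability n) D \<longrightarrow>
          real (query_time (reachability n) D) \<ge> c * (real n / real w) \<or>
          real (update_time (reachability n) D) \<ge> c * (real n / real w))"
    by (rule exI[of _ "1 / 12"]) (use reachability_bound in auto)
  show "\<exists>c::real. c > 0 \<and>
      (\<forall>n w S\<^sub>0 D. S\<^sub>0 \<subseteq> {1..n} \<and> w \<ge> 1 \<and>
        solves w (subgraph_connectivity n S\<^sub>0) D \<and>
        nonadaptive_queries w (subgraph_connectivity n S\<^sub>0) D \<longrightarrow>
          real (query_time (subgraph_connectivity n S\<^sub>0) D) \<ge> c * (real n / real w) \<or>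
          real (update_time (subgraph_connectivity n S\<^sub>0) D) \<ge> c * (real n / real w))"
    by (rule exI[of _ "1 / 12"]) (use subgraph_connectivity_bound in auto)
  show "\<exists>c::real. c > 0 \<and>
      (\<forall>n w Z D. {0..int n} \<subseteq> Z \<and> w \<ge> 1 \<and>
        solves w (range_mode n Z) D \<and> nonadaptive_queries w (range_mode n Z) D \<longrightarrow>
          real (query_time (range_mode n Z) D) * real (update_time (range_mode n Z) D)
            \<ge> c * (real n / (real w)\<^sup>2))"
    by (rule exI[of _ "1 / 40"]) (use range_mode_bound in auto)
qed

end
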